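(* (Cayley–Hamilton theorem) Let $(\mathcal A,\mathcal A_0)$ be a commutative semiring pair with a negation map $(-)$. For $A\in M_n(\mathcal A)$, let $f(\lambda)=|\lambda I(-)A|$. Then $f(A)\in\mathcal A_0$, i.e. all entries of the matrix $f(A)$ lie in $\mathcal A_0$.
   Context: $\mathcal T$ is a commutative multiplicative monoid with unit $1$, $\mathcal T_0=\mathcal T\cup\{0\}$. A semiring satisfies all ring axioms except existence of additive inverses ($0$ is additively neutral and multiplicatively absorbing). A commutative semiring pair $(\mathcal A,\mathcal A_0)$: $\mathcal A$ is a commutative semiring containing $\mathcal T_0$ (with $\mathcal T$ acting by multiplication, $\mathcal T$ a submonoid), such that $\mathcal T_0$ spans $(\mathcal A,+)$; $\mathcal A_0$ is an additive sub-semigroup containing $0$, closed under multiplication by $\mathcal T$, with $\mathcal A_0\cap\mathcal T_0=\{0\}$. Standing assumptions: for $a\in\mathcal T$, $b\in\mathcal A$, $ab\in\mathcal A_0$ implies $b\in\mathcal A_0$; $ab_1=ab_2$ implies $b_1=b_2$; and $(\mathcal A,\mathcal A_0)$ satisfies Property N: there is $1^\dag\in\mathcal T$ with $1+1^\dag\in\mathcal A_0$ and $1^\dag\mathcal T\subseteq\mathcal T$, and whenever $a_1,a_2\in\mathcal T$ and $a_1+a_2\in\mathcal A_0$, $a_1+a_2=a_1+a_11^\dag$. A negation map is an automorphism $(-)$ of $(\mathcal A,+,0)$ of order $\le2$ leaving $\mathcal T$ invariant, with $1+((-)1)\in\mathcal A_0$ and $((-)a)b=(-)(ab)=a((-)b)$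 for $a\in\mathcal T$, $b\in\mathcal A$. We write $b(-)b'=b+((-)b')$. The $(-)$-determinant of an $n\times n$ matrix $A=(a_{i,j})$ is $|A|=\sum_{\pi\in S_n}(-)^\pi a_{\pi(1),1}\cdots a_{\pi(n),n}$, where $(-)^\pi$ is the identity for even $\pi$ and $(-)$ for odd $\pi$. $f(\lambda)$ is the polynomial with coefficients in $\mathcal A$ obtained by expanding this formula over $\mathcal A[\lambda]$ (with $(-)$ applied coefficientwise), and $f(A)$ is obtained by substituting $A$ for $\lambda$, the constant term being multiplied by the identity matrix. *)

theory Defs
  imports "HOL-Computational_Algebra.Polynomial" "HOL-Combinatorics.Permutations"
    "Jordan_Normal_Form.Matrix"
begin

text \<open>
  The whole type \<open>'a\<close> is the semiring; \<open>T\<close> is the monoid of tangible elements, with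
  \<open>insert 0 T\<close> in the role of the monoid with zero adjoined, and \<open>A0\<close> is the null part.
  That \<open>0 \<notin> T\<close> follows from \<open>mult_cancel\<close> below, since \<open>0 \<noteq> 1\<close> in \<open>comm_semiring_1\<close>.
\<close>

locale comm_semiring_pair =
  fixes T A0 :: "'a :: comm_semiring_1 set"
  assumes one_T: "1 \<in> T"
    and mult_T: "a \<in> T \<Longrightarrow> b \<in> T \<Longrightarrow> a * b \<in> T"
    and T_spans: "\<exists>xs. set xs \<subseteq> insert 0 T \<and> b = sum_list xs"
    and zero_A0: "0 \<in> A0"
    and add_A0: "b \<in> A0 \<Longrightarrow> c \<in> A0 \<Longrightarrow> b + c \<in> A0"
    and T_mult_A0: "a \<in> T \<Longrightarrow> b \<in> A0 \<Longrightarrow> a * b \<in> A0"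
    and A0_Int_T0: "A0 \<inter> insert 0 T = {0}"

locale comm_semiring_pair_N = comm_semiring_pair +
  assumes A0_cancel: "a \<in> T \<Longrightarrow> a * b \<in> A0 \<Longrightarrow> b \<in> A0"
    and mult_cancel: "a \<in> T \<Longrightarrow> a * b = a * c \<Longrightarrow> b = c"
    and property_N: "\<exists>d\<in>T. 1 + d \<in> A0 \<and> (\<forall>a\<in>T. d * a \<in> T) \<and>
          (\<forall>a\<in>T. \<forall>b\<in>T. a + b \<in> A0 \<longrightarrow> a + b = a + a * d)"

text \<open>Bijectivity of the negation map is a consequence of \<open>neg_neg\<close>.\<close>

locale comm_semiring_pair_neg = comm_semiring_pair_N T A0
  for T A0 :: "'a :: comm_semiring_1 set" +
  fixes neg :: "'a \<Rightarrow> 'a"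
  assumes neg_zero: "neg 0 = 0"
    and neg_add: "neg (b + c) = neg b + neg c"
    and neg_neg: "neg (neg b) = b"
    and neg_T: "neg ` T = T"
    and one_neg_one: "1 + neg 1 \<in> A0"
    and neg_mult_left: "a \<in> T \<Longrightarrow> neg a * b = neg (a * b)"
    and neg_mult_right: "a \<in> T \<Longrightarrow> a * neg b = neg (a * b)"

definition neg_det :: "('b \<Rightarrow> 'b) \<Rightarrow> 'b mat \<Rightarrow> 'b :: comm_semiring_1" where
  "neg_det neg A = (\<Sum>\<pi> | \<pi> permutes {0..<dim_row A}.
     (if evenperm \<pi> then id else neg) (\<Prod>i = 0..<dim_row A. A $$ (\<pi> i, i)))"

definition neg_char_poly :: "('a \<Rightarrow> 'a) \<Rightarrow> 'a mat \<Rightarrow> 'a :: comm_semiring_1 poly" where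
  "neg_char_poly neg A = neg_det (map_poly neg)
     ([:0, 1:] \<cdot>\<^sub>m 1\<^sub>m (dim_row A) + map_mat (\<lambda>a. map_poly neg [:a:]) A)"

text \<open>
  Substitution of a square matrix into a polynomial, written entrywise because matrices of
  unspecified size have no additive unit.  The power \<open>A ^\<^sub>m 0\<close> is the identity matrix.
\<close>

definition poly_eval_mat :: "'a :: comm_semiring_1 poly \<Rightarrow> 'a mat \<Rightarrow> 'a mat" where
  "poly_eval_mat p A = mat (dim_row A) (dim_row A)
     (\<lambda>(i, j). \<Sum>k\<le>degree p. (coeff p k \<cdot>\<^sub>m (A ^\<^sub>m k)) $$ (i, j))"

end

theory Submission
  imports Defs "Jordan_Normal_Form.Char_Poly" "HOL-Library.Poly_Mapping"
begin

text \<open>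
  The negation map is multiplication by \<open>e = neg 1\<close>, because \<open>neg b = neg (1 * b) = neg 1 * b\<close>,
  and \<open>e * e = 1\<close>. Expanding an entry of \<open>f(A)\<close> therefore gives \<open>P + e * Q\<close>, where \<open>P\<close> and \<open>Q\<close>
  are polynomials with natural number coefficients in the entries of \<open>A\<close>, the same for all semirings.
  Over a commutative ring with \<open>e = -1\<close> the entry is \<open>P - Q\<close>, which vanishes by the classical
  Cayley--Hamilton theorem. For a matrix of indeterminates over the integers this says \<open>P = Q\<close> as
  formal polynomials. Hence \<open>P = Q\<close> also after substitution in the semiring, and the entry is
  \<open>(1 + e) * P\<close>. It lies in \<open>A0\<close>, since \<open>1 + e \<in> A0\<close> and \<open>A0\<close> is an ideal: every element of the
  semiring is a sum of elements of \<open>T\<close> and zeros, and multiplication by each of these preserves \<open>A0\<close>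
  (\<open>A0_absorbs\<close>).

  To make the formal expansion precise, let \<open>S\<close> be the semiring of polynomials over the natural
  numbers with one indeterminate \<open>X a\<close> for each element \<open>a\<close> of the given semiring. It is the type
  \<open>'a multiset \<Rightarrow>\<^sub>0 nat\<close>, a monomial being the multiset of its indeterminates. The sign becomes the
  variable of a univariate polynomial over \<open>S\<close>. An entry of \<open>f(A)\<close> is then the image of
  one element \<open>g\<close> of \<open>S poly\<close> under \<open>X a \<mapsto> a\<close>, variable \<open>\<mapsto> e\<close>, while the image of \<open>g\<close> in the
  ring of integer polynomials under variable \<open>\<mapsto> -1\<close> is zero by \<open>cayley_hamilton_comm_ring\<close>. That
  both specializations commute with the formation of \<open>f(A)\<close> is \<open>hom_neg_char_poly\<close> and
  \<open>hom_poly_eval_mat\<close>; the comparison of the two is \<open>vanishing_at_minus_one_imp_multiple\<close>.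
\<close>

section \<open>Naturality under semiring homomorphisms\<close>

text \<open>
  The bound of the sum is left free because a homomorphism may lower the degree of the polynomial;
  both sides of a naturality statement can then use the same bound.
\<close>

lemma poly_eval_mat_index:
  assumes A: "A \<in> carrier_mat n n" and ij: "i < n" "j < n" and N: "degree p \<le> N"
  shows "poly_eval_mat p A $$ (i, j) = (\<Sum>k\<le>N. coeff p k * (A ^\<^sub>m k) $$ (i, j))"
proof -
  have "A ^\<^sub>m k \<in> carrier_mat n n" for k
    using A by (rule pow_carrier_mat)
  then have "poly_eval_mat p A $$ (i, j) = (\<Sum>k\<le>degree p. coeff p k * (A ^\<^sub>m k) $$ (i, j))"
    using A ij unfolding poly_eval_mat_def by auto
  also have "\<dots> = (\<Sum>k\<le>N. coeff p k * (A ^\<^sub>m k) $$ (i, j))"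
    using N by (intro sum.mono_neutral_left) (auto simp: coeff_eq_0)
  finally show ?thesis .
qed

lemma (in comm_semiring_hom) hom_poly_eval_mat:
  assumes A: "A \<in> carrier_mat n n" and ij: "i < n" "j < n"
  shows "poly_eval_mat (map_poly hom p) (map_mat hom A) $$ (i, j) = hom (poly_eval_mat p A $$ (i, j))"
proof -
  have pw: "(map_mat hom A ^\<^sub>m k) $$ (i, j) = hom ((A ^\<^sub>m k) $$ (i, j))" for k
    using mat_hom_pow[OF A, of k] pow_carrier_mat[OF A, of k] ij by (metis carrier_matD index_map_mat(1))
  have "degree (map_poly hom p) \<le> degree p"
    by (rule degree_map_poly_le)
  then show ?thesis
    using A ij by (simp add: poly_eval_mat_index[of _ n _ _ _ "degree p"] pw hom_distribs)
qed

text \<open>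
  The determinant uses only sums, products and the negation map, so every semiring homomorphism that
  intertwines the two negation maps preserves it. The maps \<open>N\<close> and \<open>N'\<close> are arbitrary functions
  here, so that the lemma also applies to their coefficientwise extensions to polynomials.
\<close>

lemma (in comm_semiring_hom) hom_neg_det:
  assumes B: "B \<in> carrier_mat n n" and comm: "\<And>x. hom (N x) = N' (hom x)"
  shows "neg_det N' (map_mat hom B) = hom (neg_det N B)"
proof -
  have "(\<Prod>i = 0..<n. map_mat hom B $$ (\<pi> i, i)) = hom (\<Prod>i = 0..<n. B $$ (\<pi> i, i))"
    if "\<pi> permutes {0..<n}" for \<pi>
  proof -
    have "\<pi> i < n" if "i < n" for i
      using permutes_in_image[OF \<open>\<pi> permutes {0..<n}\<close>, of i] that by simp
    then show ?thesis
      using B unfolding hom_prod by (intro prod.cong) auto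
  qed
  then show ?thesis
    using B unfolding neg_det_def hom_sum by (intro sum.cong) (auto simp: comm)
qed

lemma (in comm_semiring_hom) hom_neg_char_poly:
  assumes A: "A \<in> carrier_mat n n" and N0: "N 0 = 0" and comm: "\<And>x. hom (N x) = N' (hom x)"
  shows "neg_char_poly N' (map_mat hom A) = map_poly hom (neg_char_poly N A)"
proof -
  interpret P: map_poly_comm_semiring_hom hom ..
  have N'0: "N' 0 = 0"
    using comm[of 0] N0 by simp
  have poly_comm: "map_poly hom (map_poly N p) = map_poly N' (map_poly hom p)" for p
    by (rule poly_eqI) (simp add: coeff_map_poly N0 N'0 comm)
  have "[:0, 1:] \<cdot>\<^sub>m 1\<^sub>m n + map_mat (\<lambda>a. map_poly N' [:a:]) (map_mat hom A)
      = map_mat (map_poly hom) ([:0, 1:] \<cdot>\<^sub>m 1\<^sub>m n + map_mat (\<lambda>a. map_poly N [:a:]) A)"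
    using A by (intro eq_matI) (auto simp: P.hom_add poly_comm map_poly_pCons_hom)
  moreover have "[:0, 1:] \<cdot>\<^sub>m 1\<^sub>m n + map_mat (\<lambda>a. map_poly N [:a:]) A \<in> carrier_mat n n"
    using A by auto
  ultimately show ?thesis
    using A P.hom_neg_det[of _ n "map_poly N" "map_poly N'", OF _ poly_comm]
    unfolding neg_char_poly_def by auto
qed

section \<open>The theorem over commutative rings\<close>

text \<open>
  With ordinary negation, the summand for \<open>\<pi>\<close> carries the sign of \<open>\<pi>\<close>, and the column
  expansion of the usual determinant appears.
\<close>

lemma neg_char_poly_uminus:
  fixes A :: "'a :: comm_ring_1 mat"
  assumes A: "A \<in> carrier_mat n n"
  shows "neg_char_poly uminus A = char_poly A"
proof -
  have "neg_det (map_poly uminus) B = det B" if B: "B \<in> carrier_mat n n" for B :: "'a poly mat"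
  proof -
    have "map_poly uminus p = - p" for p :: "'a poly"
      by (rule poly_eqI) (simp add: coeff_map_poly)
    then show ?thesis
      using B unfolding neg_det_def det_col[OF B] lessThan_atLeast0
      by (intro sum.cong) (auto simp: sign_def)
  qed
  moreover have "map_poly uminus [:a:] = [:- a:]" for a :: 'a
    by (cases "a = 0") (simp_all add: map_poly_pCons)
  ultimately show ?thesis
    using A char_poly_matrix_closed[OF A] unfolding neg_char_poly_def char_poly_def char_poly_matrix_def
    by simp
qed

text \<open>
  The adjugate \<open>B\<close> of \<open>\<lambda>I - A\<close> satisfies \<open>(\<lambda>I - A) B = \<chi> I\<close>. Writing \<open>C k\<close> for the matrix of the
  coefficients of \<open>\<lambda>^k\<close> in \<open>B\<close>, comparison of coefficients gives \<open>\<chi>_k I = C (k-1) - A C k\<close>. After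
  multiplication by \<open>A^k\<close> the sum over \<open>k\<close> telescopes to zero.
\<close>

lemma cayley_hamilton_comm_ring:
  fixes A :: "'a :: comm_ring_1 mat"
  assumes A: "A \<in> carrier_mat n n" and ij: "i < n" "j < n"
  shows "poly_eval_mat (char_poly A) A $$ (i, j) = 0"
proof -
  define M where "M = char_poly_matrix A"
  define B where "B = adj_mat M"
  define C where "C k = map_mat (\<lambda>p. coeff p k) B" for k
  have M: "M \<in> carrier_mat n n"
    using A unfolding M_def by simp
  have B: "B \<in> carrier_mat n n" and MB: "M * B = char_poly A \<cdot>\<^sub>m 1\<^sub>m n"
    using adj_mat[OF M] unfolding B_def char_poly_def M_def by auto
  have C: "C k \<in> carrier_mat n n" for k
    using B unfolding C_def by simp
  have pw: "A ^\<^sub>m k \<in> carrier_mat n n" for k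
    using A by (rule pow_carrier_mat)
  (* the sequence C shifted by one, with the zero matrix in the place of C (-1) *)
  define C' where "C' k = (if k = 0 then 0\<^sub>m n n else C (k - 1))" for k
  have C': "C' k \<in> carrier_mat n n" for k
    using C unfolding C'_def by simp
  have step: "coeff (char_poly A) k \<cdot>\<^sub>m 1\<^sub>m n = C' k - A * C k" for k
  proof (rule eq_matI)
    fix r c
    assume "r < dim_row (C' k - A * C k)" "c < dim_col (C' k - A * C k)"
    then have rc: "r < n" "c < n"
      using A C[of k] by auto
    have "(char_poly A \<cdot>\<^sub>m 1\<^sub>m n) $$ (r, c) = (\<Sum>l<n. M $$ (r, l) * B $$ (l, c))"
      using M B rc unfolding MB[symmetric] by (auto simp: scalar_prod_def lessThan_atLeast0)
    also have "\<dots> = (\<Sum>l<n. (if l = r then [:0, 1:] * B $$ (l, c) else 0) - Polynomial.smult (A $$ (r, l)) (B $$ (l, c)))"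
      using A rc unfolding M_def char_poly_matrix_def
      by (intro sum.cong) (auto simp: algebra_simps)
    also have "\<dots> = pCons 0 (B $$ (r, c)) - (\<Sum>l<n. Polynomial.smult (A $$ (r, l)) (B $$ (l, c)))"
      using rc by (simp add: sum_subtractf)
    finally have "coeff ((char_poly A \<cdot>\<^sub>m 1\<^sub>m n) $$ (r, c)) k
        = coeff (pCons 0 (B $$ (r, c))) k - (\<Sum>l<n. A $$ (r, l) * coeff (B $$ (l, c)) k)"
      by (simp add: coeff_sum)
    moreover have "coeff ((char_poly A \<cdot>\<^sub>m 1\<^sub>m n) $$ (r, c)) k = (coeff (char_poly A) k \<cdot>\<^sub>m 1\<^sub>m n) $$ (r, c)"
      using rc by simp
    moreover have "coeff (pCons 0 (B $$ (r, c))) k = C' k $$ (r, c)"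
      using rc B unfolding C'_def C_def by (cases k) auto
    moreover have "(\<Sum>l<n. A $$ (r, l) * coeff (B $$ (l, c)) k) = (A * C k) $$ (r, c)"
      using rc A B unfolding C_def by (auto simp: scalar_prod_def lessThan_atLeast0)
    ultimately show "(coeff (char_poly A) k \<cdot>\<^sub>m 1\<^sub>m n) $$ (r, c) = (C' k - A * C k) $$ (r, c)"
      using rc A C[of k] by auto
  qed (use A C[of k] in auto)
  define D where "D k = (A ^\<^sub>m k * C' k) $$ (i, j)" for k
  have D_step: "coeff (char_poly A) k * (A ^\<^sub>m k) $$ (i, j) = D k - D (Suc k)" for k
  proof -
    have "coeff (char_poly A) k * (A ^\<^sub>m k) $$ (i, j)
        = (A ^\<^sub>m k * (coeff (char_poly A) k \<cdot>\<^sub>m 1\<^sub>m n)) $$ (i, j)"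
      using pw[of k] A ij by (simp add: mult_smult_distrib[OF pw[of k] one_carrier_mat] right_mult_one_mat[OF pw[of k]])
    also have "\<dots> = (A ^\<^sub>m k * C' k - A ^\<^sub>m k * (A * C k)) $$ (i, j)"
      unfolding step using mult_minus_distrib_mat[OF pw[of k] C'[of k], of "A * C k"] A C[of k] by simp
    also have "A ^\<^sub>m k * (A * C k) = A ^\<^sub>m (Suc k) * C' (Suc k)"
      using assoc_mult_mat[OF pw[of k] A C[of k]] unfolding C'_def by simp
    also have "(A ^\<^sub>m k * C' k - A ^\<^sub>m (Suc k) * C' (Suc k)) $$ (i, j) = D k - D (Suc k)"
      unfolding D_def using ij pw[of "Suc k"] C'[of "Suc k"] by (intro index_minus_mat) auto
    finally show ?thesis .
  qed
  (* N also exceeds all degrees in B, which makes the upper end of the telescoping sum vanish *)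
  define N where "N = Max (insert (degree (char_poly A)) ((\<lambda>(r, c). Suc (degree (B $$ (r, c)))) ` ({..<n} \<times> {..<n})))"
  have N: "degree (char_poly A) \<le> N"
    unfolding N_def by (rule Max_ge) auto
  have "Suc (degree (B $$ (r, c))) \<le> N" if "r < n" "c < n" for r c
    unfolding N_def using that by (intro Max_ge) auto
  then have "C N = 0\<^sub>m n n"
    using B unfolding C_def by (intro eq_matI) (auto intro!: coeff_eq_0 simp: Suc_le_eq)
  then have last: "D (Suc N) = 0"
    unfolding D_def C'_def using pw[of "Suc N"] right_mult_zero_mat[OF pw[of "Suc N"]] ij by simp
  have first: "D 0 = 0"
    unfolding D_def C'_def using right_mult_zero_mat[OF pw[of 0]] ij by simp
  have "poly_eval_mat (char_poly A) A $$ (i, j) = (\<Sum>k\<le>N. D k - D (Suc k))"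
    using poly_eval_mat_index[OF A ij N] by (simp add: D_step)
  also have "\<dots> = D 0 - D (Suc N)"
    by (rule sum_telescope)
  finally show ?thesis
    using first last by simp
qed

section \<open>Monoid semirings over the natural numbers\<close>

text \<open>
  Elements of \<open>'m \<Rightarrow>\<^sub>0 nat\<close> are formal sums of elements of the monoid \<open>'m\<close>, multiplied by
  convolution. This is the additive extension of \<open>w\<close>; for multiplicative \<open>w\<close> it is the evaluation
  homomorphism given by the universal property of that semiring.
\<close>

definition monoid_semiring_eval ::
  "('m :: comm_monoid_add \<Rightarrow> 'b :: comm_semiring_1) \<Rightarrow> ('m \<Rightarrow>\<^sub>0 nat) \<Rightarrow> 'b" where
  "monoid_semiring_eval w p = (\<Sum>m\<in>Poly_Mapping.keys p. of_nat (Poly_Mapping.lookup p m) * w m)"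

lemma monoid_semiring_eval_superset:
  assumes "finite K" "Poly_Mapping.keys p \<subseteq> K"
  shows "monoid_semiring_eval w p = (\<Sum>m\<in>K. of_nat (Poly_Mapping.lookup p m) * w m)"
  unfolding monoid_semiring_eval_def using assms
  by (intro sum.mono_neutral_left) (auto simp: in_keys_iff)

lemma monoid_semiring_eval_single:
  "monoid_semiring_eval w (Poly_Mapping.single m c) = of_nat c * w m"
  by (subst monoid_semiring_eval_superset[where K = "{m}"]) auto

lemma poly_mapping_sum_single:
  "p = (\<Sum>m\<in>Poly_Mapping.keys p. Poly_Mapping.single m (Poly_Mapping.lookup p m))"
  by (rule poly_mapping_eqI) (auto simp: lookup_sum lookup_single when_def in_keys_iff)

text \<open>
  Multiplicativity is checked on monomials, into which both factors decompose; on these it is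
  \<open>w_add\<close>.
\<close>

lemma comm_semiring_hom_monoid_semiring_eval:
  fixes w :: "'m :: comm_monoid_add \<Rightarrow> 'b :: comm_semiring_1"
  assumes w0: "w 0 = 1" and w_add: "\<And>m m'. w (m + m') = w m * w m'"
  shows "comm_semiring_hom (monoid_semiring_eval w)"
proof -
  let ?h = "monoid_semiring_eval w"
  have add: "?h (p + q) = ?h p + ?h q" for p q
  proof -
    let ?K = "Poly_Mapping.keys p \<union> Poly_Mapping.keys q"
    show ?thesis
      using Poly_Mapping.keys_add[of p q]
      by (simp add: monoid_semiring_eval_superset[where K = ?K] lookup_add sum.distrib distrib_right)
  qed
  have zero: "?h 0 = 0"
    by (simp add: monoid_semiring_eval_def)
  interpret comm_monoid_add_hom ?h
    by unfold_locales (use zero add in auto)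
  have mult: "?h (p * q) = ?h p * ?h q" for p q
  proof -
    let ?s = "\<lambda>p m. Poly_Mapping.single m (Poly_Mapping.lookup p m)"
    have "p * q = (\<Sum>m\<in>Poly_Mapping.keys p. \<Sum>m'\<in>Poly_Mapping.keys q. ?s p m * ?s q m')"
      by (simp flip: sum_product poly_mapping_sum_single)
    then show ?thesis
      by (simp add: hom_sum mult_single monoid_semiring_eval_single w_add
          monoid_semiring_eval_def[of w p] monoid_semiring_eval_def[of w q] sum_product ac_simps)
  qed
  have "?h 1 = 1"
    using monoid_semiring_eval_single[of w 0 1] w0 by (simp del: One_nat_def)
  then show ?thesis
    by unfold_locales (use mult in auto)
qed

definition monoid_semiring_to_ring :: "('m :: comm_monoid_add \<Rightarrow>\<^sub>0 nat) \<Rightarrow> ('m \<Rightarrow>\<^sub>0 int)" where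
  "monoid_semiring_to_ring = monoid_semiring_eval (\<lambda>m. Poly_Mapping.single m 1)"

lemma comm_semiring_hom_monoid_semiring_to_ring: "comm_semiring_hom monoid_semiring_to_ring"
  unfolding monoid_semiring_to_ring_def
  by (rule comm_semiring_hom_monoid_semiring_eval) (simp_all add: mult_single)

text \<open>
  The coefficients are preserved, and the natural numbers embed into the integers. Through this
  injectivity an identity with subtraction becomes one without it.
\<close>

lemma inj_monoid_semiring_to_ring: "inj monoid_semiring_to_ring"
proof (rule injI)
  fix p q :: "'m :: comm_monoid_add \<Rightarrow>\<^sub>0 nat"
  have lookup: "Poly_Mapping.lookup (monoid_semiring_to_ring p) m = int (Poly_Mapping.lookup p m)"
    for p :: "'m \<Rightarrow>\<^sub>0 nat" and m
  proof -
    have "of_nat c * Poly_Mapping.single k 1 = Poly_Mapping.single k (int c)" for c and k :: 'm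
      using mult_single[of 0 "int c" k 1] by (simp add: single_of_nat)
    then show ?thesis
      by (simp add: monoid_semiring_to_ring_def monoid_semiring_eval_def lookup_sum lookup_single
          when_def in_keys_iff)
  qed
  assume "monoid_semiring_to_ring p = monoid_semiring_to_ring q"
  then show "p = q"
    by (metis lookup of_nat_eq_iff poly_mapping_eqI)
qed

section \<open>Replacing the sign by an element of square one\<close>

lemma comm_semiring_hom_poly_map_poly:
  assumes "comm_semiring_hom h"
  shows "comm_semiring_hom (\<lambda>g. poly (map_poly h g) x)"
proof -
  interpret comm_semiring_hom h by fact
  interpret P: map_poly_comm_semiring_hom h ..
  show ?thesis
    by unfold_locales (simp_all add: P.hom_add P.hom_mult)
qed

text \<open>
  The powers of an \<open>x\<close> of square one are \<open>1\<close> and \<open>x\<close>, so the value at \<open>x\<close> depends only on the sums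
  of the even and of the odd coefficients. These two sums do not involve \<open>h\<close> or \<open>x\<close>; this is what
  connects the specializations at \<open>-1\<close> and at \<open>e\<close>.
\<close>

lemma poly_map_poly_square_one:
  assumes "comm_semiring_hom h" and x: "x * x = 1"
  shows "poly (map_poly h g) x
    = h (\<Sum>k\<in>{k. k \<le> degree g \<and> even k}. coeff g k) + x * h (\<Sum>k\<in>{k. k \<le> degree g \<and> odd k}. coeff g k)"
proof -
  interpret comm_semiring_hom h by fact
  have pow: "x ^ k = (if even k then 1 else x)" for k
    by (induction k) (auto simp: x)
  have split: "{..degree g} = {k. k \<le> degree g \<and> even k} \<union> {k. k \<le> degree g \<and> odd k}"
    by auto
  have "poly (map_poly h g) x = (\<Sum>k\<le>degree g. x ^ k * h (coeff g k))"
    using eval_poly_as_sum[of h g x] by (simp add: eval_poly_def)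
  also have "\<dots> = (\<Sum>k\<in>{k. k \<le> degree g \<and> even k}. x ^ k * h (coeff g k))
      + (\<Sum>k\<in>{k. k \<le> degree g \<and> odd k}. x ^ k * h (coeff g k))"
    unfolding split by (rule sum.union_disjoint) auto
  finally show ?thesis
    by (simp add: pow hom_sum sum_distrib_left)
qed

text \<open>
  Vanishing at \<open>-1\<close> means that the even and the odd coefficient sums have the same image in the
  ring, so by injectivity they are equal already over the natural numbers. The value at \<open>e\<close> is then
  \<open>s + e * s\<close> with \<open>s\<close> the image of this common sum.
\<close>

lemma vanishing_at_minus_one_imp_multiple:
  fixes e :: "'b :: comm_semiring_1"
  assumes "comm_semiring_hom h" and e: "e * e = 1"
    and vanish: "poly (map_poly monoid_semiring_to_ring g) (- 1) = 0"
  obtains c where "poly (map_poly h g) e = (1 + e) * c"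
proof -
  let ?E = "\<Sum>k\<in>{k. k \<le> degree g \<and> even k}. coeff g k"
  let ?O = "\<Sum>k\<in>{k. k \<le> degree g \<and> odd k}. coeff g k"
  have "monoid_semiring_to_ring ?E = monoid_semiring_to_ring ?O"
    using vanish poly_map_poly_square_one[OF comm_semiring_hom_monoid_semiring_to_ring, of "- 1" g]
    by simp
  then have "?E = ?O"
    by (rule injD[OF inj_monoid_semiring_to_ring])
  then have "poly (map_poly h g) e = (1 + e) * h ?O"
    using poly_map_poly_square_one[OF assms(1) e, of g] by (simp add: distrib_right)
  then show ?thesis
    by (rule that)
qed

text \<open>
  The semiring version of the theorem: with the sign \<open>-1\<close> replaced by any \<open>e\<close> of square one, the
  entries of \<open>f(A)\<close> lie in the principal ideal generated by \<open>1 + e\<close>. For \<open>e = -1\<close> in a ring this is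
  the classical theorem. The entry is lifted to \<open>g\<close>, formed from the matrix of indeterminates
  with the polynomial variable as the sign, and \<open>specialize\<close> carries \<open>g\<close> along both substitutions.
\<close>

theorem cayley_hamilton_square_one:
  fixes A :: "'a :: comm_semiring_1 mat"
  assumes A: "A \<in> carrier_mat n n" and ij: "i < n" "j < n" and e: "e * e = 1"
  obtains c where "poly_eval_mat (neg_char_poly ((*) e) A) A $$ (i, j) = (1 + e) * c"
proof -
  let ?ev = "monoid_semiring_eval prod_mset :: ('a multiset \<Rightarrow>\<^sub>0 nat) \<Rightarrow> 'a"
  define X where "X a = [:Poly_Mapping.single {#a#} (1 :: nat):]" for a :: 'a
  define g where "g = poly_eval_mat (neg_char_poly ((*) [:0, 1:]) (map_mat X A)) (map_mat X A) $$ (i, j)"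
  have XA: "map_mat X A \<in> carrier_mat n n"
    using A by simp
  have specialize: "poly_eval_mat (neg_char_poly ((*) x) (map_mat (\<lambda>a. poly (map_poly h (X a)) x) A))
      (map_mat (\<lambda>a. poly (map_poly h (X a)) x) A) $$ (i, j) = poly (map_poly h g) x"
    if "comm_semiring_hom h" for h :: "('a multiset \<Rightarrow>\<^sub>0 nat) \<Rightarrow> 'c :: comm_semiring_1" and x
  proof -
    interpret h: comm_semiring_hom h by fact
    interpret H: comm_semiring_hom "\<lambda>g. poly (map_poly h g) x"
      using that by (rule comm_semiring_hom_poly_map_poly)
    have "poly (map_poly h ([:0, 1:] * p)) x = x * poly (map_poly h p) x" for p
      by (simp add: H.hom_mult h.map_poly_pCons_hom)
    moreover have map_mat_X: "map_mat (\<lambda>a. poly (map_poly h (X a)) x) A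
        = map_mat (\<lambda>g. poly (map_poly h g) x) (map_mat X A)"
      by (rule eq_matI) auto
    ultimately show ?thesis
      unfolding g_def H.hom_poly_eval_mat[OF XA ij, symmetric]
      by (subst H.hom_neg_char_poly[OF XA, symmetric, where N' = "(*) x"])
        (auto simp: map_mat_X)
  qed
  have ev: "comm_semiring_hom ?ev"
    by (rule comm_semiring_hom_monoid_semiring_eval) auto
  then interpret ev: comm_semiring_hom ?ev .
  have "poly (map_poly ?ev (X a)) e = a" for a
    unfolding X_def ev.map_poly_pCons_hom monoid_semiring_eval_single by simp
  moreover have "map_mat (\<lambda>a. a) A = A"
    by (rule eq_matI) auto
  ultimately have target: "poly_eval_mat (neg_char_poly ((*) e) A) A $$ (i, j) = poly (map_poly ?ev g) e"
    using specialize[OF ev, of e] by simp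
  let ?Z = "map_mat (\<lambda>a. poly (map_poly monoid_semiring_to_ring (X a)) (- 1)) A"
  have Z: "?Z \<in> carrier_mat n n"
    using A by simp
  have "(*) (- 1) = (uminus :: ('a multiset \<Rightarrow>\<^sub>0 int) \<Rightarrow> _)"
    by auto
  then have "poly (map_poly monoid_semiring_to_ring g) (- 1) = 0"
    using specialize[OF comm_semiring_hom_monoid_semiring_to_ring, of "- 1"]
      cayley_hamilton_comm_ring[OF Z ij] neg_char_poly_uminus[OF Z]
    by simp
  from vanishing_at_minus_one_imp_multiple[OF ev e this] show ?thesis
    using target that by metis
qed

section \<open>Semiring pairs\<close>

text \<open>
  Since \<open>T\<close> and \<open>0\<close> span the semiring, closure of \<open>A0\<close> under sums and under multiplication by \<open>T\<close>
  already makes it an ideal.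
\<close>

lemma (in comm_semiring_pair) A0_absorbs:
  assumes "b \<in> A0"
  shows "b * c \<in> A0"
proof -
  obtain xs where xs: "set xs \<subseteq> insert 0 T" "c = sum_list xs"
    using T_spans by blast
  have "b * sum_list xs \<in> A0"
    using xs(1)
  proof (induction xs)
    case (Cons x xs)
    then have "x * b \<in> A0"
      using assms T_mult_A0 zero_A0 by auto
    with Cons show ?case
      by (simp add: distrib_left add_A0 mult.commute)
  qed (simp add: zero_A0)
  then show ?thesis
    using xs(2) by simp
qed

theorem theorem5:
  fixes T A0 :: "'a :: comm_semiring_1 set" and neg :: "'a \<Rightarrow> 'a"
    and A :: "'a mat" and n :: nat
  assumes "comm_semiring_pair_neg T A0 neg"
    and "A \<in> carrier_mat n n"
  shows "\<forall>i<n. \<forall>j<n. poly_eval_mat (neg_char_poly neg A) A $$ (i, j) \<in> A0"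
proof (intro allI impI)
  fix i j
  assume ij: "i < n" "j < n"
  interpret comm_semiring_pair_neg T A0 neg by fact
  have neg: "neg = (*) (neg 1)"
    using neg_mult_left[OF one_T] by auto
  have "neg 1 * neg 1 = 1"
    using neg_mult_left[OF one_T, of "neg 1"] by (simp add: neg_neg)
  then obtain c where "poly_eval_mat (neg_char_poly ((*) (neg 1)) A) A $$ (i, j) = (1 + neg 1) * c"
    using cayley_hamilton_square_one[OF assms(2) ij] by blast
  then show "poly_eval_mat (neg_char_poly neg A) A $$ (i, j) \<in> A0"
    using A0_absorbs[OF one_neg_one] neg by metis
qed

end
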